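(* Let $p$ be a prime number. Let $G$ be a finite $p$-group and $\operatorname{Cl}(a)$ be a conjugacy class of $G$. Then one of the following holds: (i) $|\operatorname{Cl}(a)|=1$ and $\eta(\operatorname{Cl}(a)\operatorname{Cl}(a^{-1}))=1$; (ii) $|\operatorname{Cl}(a)|=p$ and $\eta(\operatorname{Cl}(a)\operatorname{Cl}(a^{-1}))=p$; (iii) $|\operatorname{Cl}(a)|\geq p^2$ and $\eta(\operatorname{Cl}(a)\operatorname{Cl}(a^{-1}))\geq 2p-1$.
   Context: For a finite group $G$ and $a\in G$, $\operatorname{Cl}(a)=\{gag^{-1}\mid g\in G\}$ is the conjugacy class of $a$ in $G$. For subsets $X,Y$ of $G$, $XY=\{xy\mid x\in X, y\in Y\}$. If a subset $X$ of $G$ is $G$-invariant (stable under conjugation by all elements of $G$), then $X$ is a union of $m$ distinct conjugacy classes of $G$ for some integer $m$, and $\eta(X)=m$ denotes this number. A product of two conjugacy classes is $G$-invariant. *)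

theory Defs
  imports "HOL-Algebra.Algebra" "HOL-Computational_Algebra.Primes"
begin

definition conj_class :: "('a, 'b) monoid_scheme \<Rightarrow> 'a \<Rightarrow> 'a set" where
  "conj_class G a = {g \<otimes>\<^bsub>G\<^esub> a \<otimes>\<^bsub>G\<^esub> inv\<^bsub>G\<^esub> g | g. g \<in> carrier G}"

definition conj_classes :: "('a, 'b) monoid_scheme \<Rightarrow> 'a set set" where
  "conj_classes G = conj_class G ` carrier G"

text \<open>
  \<open>eta G S\<close> is meaningful for conjugation-invariant \<open>S\<close>, where it is the number of classes
  whose union is \<open>S\<close> (lemmas \<open>Union_conj_classes_eq\<close> and \<open>eta_eqI\<close>); the set \<open>S\<close> to which
  it is applied is a product of two classes (lemma \<open>conj_class_mult_invariant\<close>).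
\<close>

definition eta :: "('a, 'b) monoid_scheme \<Rightarrow> 'a set \<Rightarrow> nat" where
  "eta G S = card {C \<in> conj_classes G. C \<subseteq> S}"

definition conj_invariant :: "('a, 'b) monoid_scheme \<Rightarrow> 'a set \<Rightarrow> bool" where
  "conj_invariant G S \<longleftrightarrow> S \<subseteq> carrier G \<and>
    (\<forall>g \<in> carrier G. \<forall>x \<in> S. g \<otimes>\<^bsub>G\<^esub> x \<otimes>\<^bsub>G\<^esub> inv\<^bsub>G\<^esub> g \<in> S)"

context group
begin

lemma conj_conj:
  assumes "g \<in> carrier G" "h \<in> carrier G" "a \<in> carrier G"
  shows "g \<otimes> (h \<otimes> a \<otimes> inv h) \<otimes> inv g = (g \<otimes> h) \<otimes> a \<otimes> inv (g \<otimes> h)"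
  using assms by (simp add: inv_mult_group m_assoc)

lemma conj_class_self:
  assumes "a \<in> carrier G"
  shows "a \<in> conj_class G a"
  unfolding conj_class_def using assms by (force intro: exI[of _ "\<one>"])

lemma conj_class_invariant:
  assumes "a \<in> carrier G"
  shows "conj_invariant G (conj_class G a)"
proof -
  have "g \<otimes> x \<otimes> inv g \<in> conj_class G a"
    if g: "g \<in> carrier G" and x: "x \<in> conj_class G a" for g x
  proof -
    obtain h where h: "h \<in> carrier G" "x = h \<otimes> a \<otimes> inv h"
      using x unfolding conj_class_def by blast
    have "g \<otimes> x \<otimes> inv g = (g \<otimes> h) \<otimes> a \<otimes> inv (g \<otimes> h)"
      unfolding h(2) by (rule conj_conj[OF g h(1) assms])
    then show ?thesis
      unfolding conj_class_def using m_closed[OF g h(1)] by blast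
  qed
  moreover have "conj_class G a \<subseteq> carrier G"
    unfolding conj_class_def using assms by auto
  ultimately show ?thesis unfolding conj_invariant_def by blast
qed

lemma conj_class_least:
  assumes "conj_invariant G S" "a \<in> S"
  shows "conj_class G a \<subseteq> S"
  using assms unfolding conj_invariant_def conj_class_def by blast

lemma conj_class_eq:
  assumes "a \<in> carrier G" "b \<in> conj_class G a"
  shows "conj_class G b = conj_class G a"
proof
  show "conj_class G b \<subseteq> conj_class G a"
    by (rule conj_class_least[OF conj_class_invariant[OF assms(1)] assms(2)])
  obtain g where g: "g \<in> carrier G" "b = g \<otimes> a \<otimes> inv g"
    using assms(2) unfolding conj_class_def by blast
  have b: "b \<in> carrier G" using g assms(1) by simp
  have "inv g \<otimes> b \<otimes> inv (inv g) = a"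
    unfolding g(2) using g(1) assms(1) conj_conj[of "inv g" g a] by simp
  then have "a \<in> conj_class G b"
    unfolding conj_class_def using inv_closed[OF g(1)] by blast
  then show "conj_class G a \<subseteq> conj_class G b"
    by (rule conj_class_least[OF conj_class_invariant[OF b]])
qed

lemma Union_conj_classes_eq:
  assumes "conj_invariant G S"
  shows "\<Union> {C \<in> conj_classes G. C \<subseteq> S} = S"
proof
  show "S \<subseteq> \<Union> {C \<in> conj_classes G. C \<subseteq> S}"
  proof
    fix x assume x: "x \<in> S"
    then have "x \<in> carrier G" using assms unfolding conj_invariant_def by blast
    then show "x \<in> \<Union> {C \<in> conj_classes G. C \<subseteq> S}"
      using conj_class_self conj_class_least[OF assms x] unfolding conj_classes_def by blast
  qed
qed blast

lemma eta_eqI: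
  assumes "A \<subseteq> conj_classes G" "S = \<Union> A"
  shows "eta G S = card A"
proof -
  have "{C \<in> conj_classes G. C \<subseteq> S} = A"
  proof (intro equalityI subsetI)
    fix C assume "C \<in> {C \<in> conj_classes G. C \<subseteq> S}"
    then obtain x where x: "x \<in> carrier G" "C = conj_class G x" and sub: "C \<subseteq> S"
      by (auto simp: conj_classes_def)
    have "x \<in> C"
      unfolding x(2) by (rule conj_class_self[OF x(1)])
    then have "x \<in> \<Union> A"
      using sub assms(2) by (simp add: subset_iff)
    then obtain D where D: "D \<in> A" "x \<in> D"
      by (rule UnionE)
    then have "D \<in> conj_classes G"
      using assms(1) by (simp add: subset_iff)
    then obtain y where y: "y \<in> carrier G" "D = conj_class G y"
      by (auto simp: conj_classes_def)
    then have "C = D"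
      using conj_class_eq[OF y(1)] D(2) x(2) by simp
    then show "C \<in> A"
      using D(1) by simp
  next
    fix C assume "C \<in> A"
    then show "C \<in> {C \<in> conj_classes G. C \<subseteq> S}"
      using assms by (simp add: subset_iff Union_upper) blast
  qed
  then show ?thesis
    by (simp add: eta_def)
qed

lemma conj_class_mult_invariant:
  assumes "a \<in> carrier G" "b \<in> carrier G"
  shows "conj_invariant G (conj_class G a <#> conj_class G b)"
proof -
  have "g \<otimes> (x \<otimes> y) \<otimes> inv g \<in> conj_class G a <#> conj_class G b"
    if g: "g \<in> carrier G" and x: "x \<in> conj_class G a" and y: "y \<in> conj_class G b" for g x y
  proof -
    have c: "x \<in> carrier G" "y \<in> carrier G"
      using x y assms conj_class_invariant unfolding conj_invariant_def by blast+
    have "inv g \<otimes> (g \<otimes> (y \<otimes> inv g)) = y \<otimes> inv g"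
      using g c by (simp add: m_assoc[symmetric])
    then have "g \<otimes> (x \<otimes> y) \<otimes> inv g = (g \<otimes> x \<otimes> inv g) \<otimes> (g \<otimes> y \<otimes> inv g)"
      using g c by (simp add: m_assoc)
    moreover have "g \<otimes> x \<otimes> inv g \<in> conj_class G a" "g \<otimes> y \<otimes> inv g \<in> conj_class G b"
      using g x y assms conj_class_invariant unfolding conj_invariant_def by blast+
    ultimately show ?thesis unfolding set_mult_def by blast
  qed
  then have "\<forall>g \<in> carrier G. \<forall>z \<in> conj_class G a <#> conj_class G b.
      g \<otimes> z \<otimes> inv g \<in> conj_class G a <#> conj_class G b"
    by (simp add: set_mult_def[of G "conj_class G a" "conj_class G b"])
  moreover have "conj_class G a <#> conj_class G b \<subseteq> carrier G"
    using conj_class_invariant[OF assms(1)] conj_class_invariant[OF assms(2)]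
    by (intro set_mult_closed) (simp_all add: conj_invariant_def)
  ultimately show ?thesis
    unfolding conj_invariant_def by (intro conjI)
qed

end

end

theory Submission
  imports Defs
begin

text \<open>
  Write \<open>[x, a] = x a x\<inverse> a\<inverse>\<close>. Every element of \<open>Cl(a) Cl(a\<inverse>)\<close> is conjugate to some \<open>[x, a]\<close>,
  so \<open>\<eta>(Cl(a) Cl(a\<inverse>))\<close> is the number of classes of \<open>G\<close> that meet the set of all
  \<open>[x, a]\<close> (lemma \<open>eta_conj_class_mult_inv\<close>). This set is the translate \<open>Cl(a) a\<inverse>\<close>, hence
  \<open>\<eta> \<le> |Cl(a)|\<close>. With \<open>|Cl(a)| = p\<^sup>m\<close>, the statement follows from the lower bound
  \<open>\<eta> \<ge> 1 + m (p - 1)\<close>: for \<open>m = 0\<close> and \<open>m = 1\<close> the two bounds coincide, and for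
  \<open>m \<ge> 2\<close> the lower one is at least \<open>2p - 1\<close>.

  The lower bound is proved for the commutators \<open>[x, a]\<close> with \<open>x\<close> in an arbitrary subgroup
  \<open>K\<close> of \<open>G\<close>, by induction on \<open>|K|\<close>, where \<open>p\<^sup>m\<close> becomes the index in \<open>K\<close> of the
  centralizer of \<open>a\<close> in \<open>K\<close> (theorem \<open>card_commutator_classes_ge\<close>). If \<open>K\<close> does not
  centralize \<open>a\<close>, choose a normal subgroup \<open>N\<close> of \<open>G\<close>, as large as possible, that does not
  contain all \<open>[x, a]\<close>, \<open>x \<in> K\<close>. The center of the \<open>p\<close>-group \<open>G/N\<close> is nontrivial, so by
  maximality of \<open>N\<close> all \<open>[x, a]\<close> are central modulo \<open>N\<close>. Two things follow. First,
  \<open>x \<mapsto> [x, a] N\<close> is a homomorphism on \<open>K\<close>; its image is a nontrivial \<open>p\<close>-group, of order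
  \<open>p\<^sup>j\<close> with \<open>j > 0\<close>. Second, \<open>[x, a]\<close> and \<open>[y, a]\<close> are conjugate in \<open>G\<close> only if they
  are equal modulo \<open>N\<close>. So the \<open>[x, a]\<close> outside \<open>N\<close> meet at least
  \<open>p\<^sup>j - 1 \<ge> j (p - 1)\<close> classes, none of which lies in \<open>N\<close>. The \<open>[x, a]\<close> inside \<open>N\<close> are
  those with \<open>x\<close> in the kernel \<open>K'\<close> (lemma \<open>classes_outside_kernel\<close>). It has index \<open>p\<^sup>j\<close>
  in \<open>K\<close> and still contains the centralizer, so the induction hypothesis supplies the
  remaining \<open>1 + (m - j) (p - 1)\<close> classes.
\<close>

section \<open>Commutators, centers and the class equation\<close>

definition commutator :: "('a, 'b) monoid_scheme \<Rightarrow> 'a \<Rightarrow> 'a \<Rightarrow> 'a" where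
  "commutator G x a = x \<otimes>\<^bsub>G\<^esub> a \<otimes>\<^bsub>G\<^esub> inv\<^bsub>G\<^esub> x \<otimes>\<^bsub>G\<^esub> inv\<^bsub>G\<^esub> a"

context group
begin

lemma commutator_closed [simp]:
  "x \<in> carrier G \<Longrightarrow> a \<in> carrier G \<Longrightarrow> commutator G x a \<in> carrier G"
  by (simp add: commutator_def)

text \<open>
  Modulo a normal subgroup containing \<open>[x, [y, a]]\<close> the conjugation by \<open>x\<close> disappears, which
  is how \<open>x \<mapsto> [x, a]\<close> becomes a homomorphism.
\<close>
lemma commutator_mult:
  assumes "x \<in> carrier G" "y \<in> carrier G" "a \<in> carrier G"
  shows "commutator G (x \<otimes> y) a = x \<otimes> commutator G y a \<otimes> inv x \<otimes> commutator G x a"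
proof -
  have cancel: "inv u \<otimes> (u \<otimes> v) = v" if "u \<in> carrier G" "v \<in> carrier G" for u v
    using that by (simp add: m_assoc[symmetric])
  show ?thesis
    using assms by (simp add: commutator_def m_assoc inv_mult_group cancel)
qed

lemma commutator_eq_one_iff:
  assumes "x \<in> carrier G" "a \<in> carrier G"
  shows "commutator G x a = \<one> \<longleftrightarrow> x \<otimes> a = a \<otimes> x"
proof -
  have "commutator G x a = (x \<otimes> a) \<otimes> inv (a \<otimes> x)"
    using assms by (simp add: commutator_def m_assoc inv_mult_group)
  then show ?thesis
    using assms by (metis inv_closed m_closed r_inv inv_equality inv_inv)
qed

lemma conj_fixed_iff_commute:
  assumes "x \<in> carrier G" "a \<in> carrier G"
  shows "x \<otimes> a \<otimes> inv x = a \<longleftrightarrow> x \<otimes> a = a \<otimes> x"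
  using assms by (metis inv_solve_right m_closed)

text \<open>
  The orbit-stabilizer theorem; the centralizer of \<open>a\<close> is written through commutators because
  the induction below is about those.
\<close>
lemma conj_class_card:
  assumes "a \<in> carrier G"
  shows "card (conj_class G a) * card {x \<in> carrier G. commutator G x a = \<one>} = order G"
proof -
  interpret conj: group_action G "carrier G" "\<lambda>g. \<lambda>h \<in> carrier G. g \<otimes> h \<otimes> inv g"
    by (rule action_by_conjugation)
  have "x \<otimes> a \<otimes> inv x = a \<longleftrightarrow> commutator G x a = \<one>" if "x \<in> carrier G" for x
    using that assms by (simp add: commutator_eq_one_iff conj_fixed_iff_commute)
  then show ?thesis
    using conj.orbit_stabilizer_theorem[OF assms] assms
    by (simp add: orbit_def stabilizer_def conj_class_def cong: conj_cong)
qed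

lemma class_equation:
  assumes "finite (carrier G)"
  shows "(\<Sum>C \<in> conj_classes G. card C) = order G"
proof -
  interpret conj: group_action G "carrier G" "\<lambda>g. \<lambda>h \<in> carrier G. g \<otimes> h \<otimes> inv g"
    by (rule action_by_conjugation)
  have "orbits G (carrier G) (\<lambda>g. \<lambda>h \<in> carrier G. g \<otimes> h \<otimes> inv g) = conj_classes G"
    by (auto simp: orbits_def orbit_def conj_classes_def conj_class_def)
  then show ?thesis
    using conj.disjoint_sum[OF assms, of "\<lambda>_. 1 :: nat"] by (simp add: order_def)
qed

lemma center_normal: "{z \<in> carrier G. \<forall>g \<in> carrier G. g \<otimes> z = z \<otimes> g} \<lhd> G" (is "?Z \<lhd> G")
  unfolding normal_inv_iff
proof (intro conjI ballI subgroupI)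
  show "inv x \<in> ?Z" if x: "x \<in> ?Z" for x
  proof -
    have "g \<otimes> inv x = inv x \<otimes> g" if g: "g \<in> carrier G" for g
    proof -
      have xG: "x \<in> carrier G" and "inv g \<otimes> x = x \<otimes> inv g"
        using x g by simp_all
      then have "inv (inv g \<otimes> x) = inv (x \<otimes> inv g)"
        by (rule_tac arg_cong)
      then show ?thesis
        using xG g by (simp add: inv_mult_group)
    qed
    then show ?thesis using x by simp
  qed
  show "x \<otimes> y \<in> ?Z" if xy: "x \<in> ?Z" "y \<in> ?Z" for x y
  proof -
    have xyG: "x \<in> carrier G" "y \<in> carrier G"
      using xy by blast+
    have "g \<otimes> (x \<otimes> y) = x \<otimes> y \<otimes> g" if g: "g \<in> carrier G" for g
    proof -
      have gx: "g \<otimes> x = x \<otimes> g" and gy: "g \<otimes> y = y \<otimes> g"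
        using xy g by blast+
      have "g \<otimes> (x \<otimes> y) = x \<otimes> g \<otimes> y"
        using xyG g by (simp only: m_assoc[symmetric] gx)
      also have "\<dots> = x \<otimes> y \<otimes> g"
        using xyG g by (simp only: m_assoc gy)
      finally show ?thesis .
    qed
    then show ?thesis using xyG by blast
  qed
  show "x \<otimes> h \<otimes> inv x \<in> ?Z" if x: "x \<in> carrier G" and h: "h \<in> ?Z" for x h
  proof -
    have "x \<otimes> h \<otimes> inv x = h"
      using x h conj_fixed_iff_commute[of x h] by blast
    then show ?thesis using h by (simp only:)
  qed
qed auto

text \<open>
  If only the identity were central, every class but \<open>{\<one>}\<close> would have size divisible by \<open>p\<close>,
  and the class equation would give \<open>p\<^sup>n \<equiv> 1\<close> modulo \<open>p\<close>.
\<close>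
lemma p_group_nontrivial_center:
  assumes p: "Factorial_Ring.prime (p :: nat)" and fin: "finite (carrier G)"
    and ord: "order G = p ^ n" and n: "n > 0"
  shows "\<exists>z \<in> carrier G. z \<noteq> \<one> \<and> (\<forall>g \<in> carrier G. g \<otimes> z = z \<otimes> g)"
proof (rule ccontr)
  assume no: "\<not> ?thesis"
  have one_class: "conj_class G \<one> = {\<one>}"
    using conj_class_self[OF one_closed] by (auto simp: conj_class_def)
  have "p dvd card C" if C: "C \<in> conj_classes G - {{\<one>}}" for C
  proof -
    obtain x where x: "x \<in> carrier G" "C = conj_class G x"
      using C by (auto simp: conj_classes_def)
    have "x \<noteq> \<one>" using x C one_class by auto
    then obtain g where g: "g \<in> carrier G" "g \<otimes> x \<noteq> x \<otimes> g"
      using no x by blast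
    have "card C dvd p ^ n"
      using conj_class_card[OF x(1)] ord x(2) by (metis dvd_triv_left)
    then obtain i where i: "card C = p ^ i"
      using p divides_primepow_nat by blast
    have "card C \<noteq> 1"
    proof
      assume "card C = 1"
      then have "card {y \<in> carrier G. commutator G y x = \<one>} = card (carrier G)"
        using conj_class_card[OF x(1)] x(2) by (simp add: order_def)
      then have "{y \<in> carrier G. commutator G y x = \<one>} = carrier G"
        by (intro card_subset_eq fin) auto
      then show False
        using g x(1) commutator_eq_one_iff by blast
    qed
    then show ?thesis
      using i by (cases i) auto
  qed
  then have "p dvd (\<Sum>C \<in> conj_classes G - {{\<one>}}. card C)"
    by (rule dvd_sum)
  moreover have "(\<Sum>C \<in> conj_classes G. card C) = 1 + (\<Sum>C \<in> conj_classes G - {{\<one>}}. card C)"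
    using sum.remove[of "conj_classes G" "{\<one>}" card] one_class fin
    by (force simp: conj_classes_def)
  moreover have "p dvd (\<Sum>C \<in> conj_classes G. card C)"
    using class_equation[OF fin] ord n by simp
  ultimately have "p dvd 1"
    by (metis dvd_add_left_iff)
  then show False
    using p not_prime_unit by blast
qed

end

section \<open>Homomorphisms and quotients\<close>

lemma (in group_hom) hom_commutator:
  assumes "x \<in> carrier G" "a \<in> carrier G"
  shows "h (commutator G x a) = commutator H (h x) (h a)"
  using assms by (simp add: commutator_def)

lemma (in group_hom) hom_commutator_eq_one_iff:
  assumes "x \<in> carrier G" "a \<in> carrier G"
  shows "h (commutator G x a) = \<one>\<^bsub>H\<^esub> \<longleftrightarrow> h x \<otimes>\<^bsub>H\<^esub> h a = h a \<otimes>\<^bsub>H\<^esub> h x"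
  using assms by (simp add: hom_commutator H.commutator_eq_one_iff)

lemma (in group_hom) normal_vimage:
  assumes "N \<lhd> H"
  shows "{x \<in> carrier G. h x \<in> N} \<lhd> G"
proof -
  interpret N: normal N H by (rule assms)
  show ?thesis
    unfolding G.normal_inv_iff
    by (intro conjI ballI G.subgroupI) (auto intro: N.inv_op_closed2)
qed

lemma (in group_hom) card_image_mult_card_kernel:
  "card (h ` carrier G) * card (kernel G H h) = order G"
proof -
  \<comment> \<open>Shrinking the codomain to the image makes \<open>h\<close> onto, as the isomorphism theorem requires.\<close>
  have "group_hom G (H\<lparr>carrier := h ` carrier G\<rparr>) h"
    by (intro group_hom.intro group_hom_axioms.intro G.group_axioms
        H.subgroup_imp_group img_is_subgroup) (auto simp: hom_def)
  then have "(\<lambda>A. the_elem (h ` A)) \<in> iso (G Mod (kernel G H h)) (H\<lparr>carrier := h ` carrier G\<rparr>)"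
    using group_hom.FactGroup_iso_set[of G "H\<lparr>carrier := h ` carrier G\<rparr>" h]
    by (simp add: kernel_def)
  then have "card (rcosets (kernel G H h)) = card (h ` carrier G)"
    using bij_betw_same_card by (fastforce simp: iso_def FactGroup_def)
  then show ?thesis
    using G.lagrange[OF subgroup_kernel] by simp
qed

lemma (in normal) quotient_group_hom:
  "group_hom G (G Mod H) (\<lambda>x. H #> x)"
  by (intro group_hom.intro group_hom_axioms.intro is_group factorgroup_is_group r_coset_hom_Mod)

lemma (in normal) coset_eq_one_iff:
  "x \<in> carrier G \<Longrightarrow> H #> x = \<one>\<^bsub>G Mod H\<^esub> \<longleftrightarrow> x \<in> H"
  using coset_join1[OF _ _ subgroup_axioms] coset_join2[OF _ subgroup_axioms]
  by (metis one_FactGroup)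

section \<open>A normal subgroup modulo which commutators are central\<close>

text \<open>
  \<open>M\<close> is the preimage of the center of \<open>G/N\<close>, which is nontrivial because \<open>G/N\<close> is a nontrivial
  \<open>p\<close>-group.
\<close>
lemma (in group) p_group_normal_extension:
  assumes p: "Factorial_Ring.prime (p :: nat)" and fin: "finite (carrier G)"
    and ord: "order G = p ^ n" and N: "N \<lhd> G" "N \<noteq> carrier G"
  obtains M where "M \<lhd> G" "N \<subset> M"
    "\<And>g z. g \<in> carrier G \<Longrightarrow> z \<in> M \<Longrightarrow> commutator G g z \<in> N"
proof -
  interpret N: normal N G by (rule N(1))
  \<comment> \<open>Opaque names for the quotient and its projection keep products of cosets from being
      unfolded to products of sets.\<close>
  define Q where "Q = G Mod N"
  define \<pi> where "\<pi> = (\<lambda>x. N #> x)"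
  interpret \<pi>: group_hom G Q \<pi>
    unfolding Q_def \<pi>_def by (rule N.quotient_group_hom)
  have ker: "\<pi> x = \<one>\<^bsub>Q\<^esub> \<longleftrightarrow> x \<in> N" if "x \<in> carrier G" for x
    using N.coset_eq_one_iff[OF that] by (simp add: Q_def \<pi>_def)
  have onto: "\<pi> ` carrier G = carrier Q"
    by (simp add: Q_def \<pi>_def carrier_FactGroup)
  define M where
    "M = {x \<in> carrier G. \<pi> x \<in> {z \<in> carrier Q. \<forall>g \<in> carrier Q. g \<otimes>\<^bsub>Q\<^esub> z = z \<otimes>\<^bsub>Q\<^esub> g}}"
  have "M \<lhd> G"
    unfolding M_def by (intro \<pi>.normal_vimage \<pi>.H.center_normal)
  have "N \<subseteq> M"
  proof
    fix x assume "x \<in> N"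
    then have "x \<in> carrier G" "\<pi> x = \<one>\<^bsub>Q\<^esub>" using ker N.subset by auto
    then show "x \<in> M" by (simp add: M_def)
  qed
  have quot: "order Q * card N = p ^ n"
    using lagrange[OF N.subgroup_axioms] ord by (simp add: Q_def FactGroup_def order_def)
  then obtain m where m: "order Q = p ^ m"
    using p divides_primepow_nat by (metis dvd_triv_left)
  have "card N < card (carrier G)"
    using N(2) N.subset fin by (meson psubsetI psubset_card_mono)
  then have "m > 0"
    using quot m ord by (cases m) (auto simp: order_def)
  then obtain z' where z': "z' \<in> carrier Q" "z' \<noteq> \<one>\<^bsub>Q\<^esub>"
      "\<forall>g \<in> carrier Q. g \<otimes>\<^bsub>Q\<^esub> z' = z' \<otimes>\<^bsub>Q\<^esub> g"
    using \<pi>.H.p_group_nontrivial_center[OF p _ m] fin onto by (metis finite_imageI)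
  then obtain z where z: "z \<in> carrier G" "z' = \<pi> z"
    using onto by blast
  have "z \<in> M" "z \<notin> N"
    using z z' ker by (auto simp: M_def)
  moreover have "commutator G g z \<in> N" if "g \<in> carrier G" "z \<in> M" for g z
    using that ker[of "commutator G g z"] \<pi>.hom_commutator_eq_one_iff[of g z] by (simp add: M_def)
  ultimately show ?thesis
    using \<open>M \<lhd> G\<close> \<open>N \<subseteq> M\<close> that by blast
qed

text \<open>
  A maximal normal subgroup \<open>N\<close> among those that do not contain \<open>T\<close> works: the larger normal
  subgroup \<open>M\<close> that is central modulo \<open>N\<close> must contain \<open>T\<close>.
\<close>
lemma (in group) p_group_separating_normal:
  assumes p: "Factorial_Ring.prime (p :: nat)" and fin: "finite (carrier G)"
    and ord: "order G = p ^ n" and T: "T \<subseteq> carrier G" "\<not> T \<subseteq> {\<one>}"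
  obtains N where "N \<lhd> G" "\<not> T \<subseteq> N"
    "\<And>g t. g \<in> carrier G \<Longrightarrow> t \<in> T \<Longrightarrow> commutator G g t \<in> N"
proof -
  define \<N> where "\<N> = {N. N \<lhd> G \<and> \<not> T \<subseteq> N}"
  have "{\<one>} \<in> \<N>"
    using T one_is_normal by (simp add: \<N>_def)
  moreover have "finite \<N>"
    using fin by (rule_tac finite_subset[of _ "Pow (carrier G)"])
      (auto simp: \<N>_def dest: normal_imp_subgroup subgroup.subset)
  ultimately obtain N where N: "N \<in> \<N>" and max: "\<And>M. M \<in> \<N> \<Longrightarrow> N \<subseteq> M \<Longrightarrow> N = M"
    by (metis finite_has_maximal2)
  have "N \<lhd> G" "N \<noteq> carrier G"
    using N T by (auto simp: \<N>_def)
  then obtain M where M: "M \<lhd> G" "N \<subset> M"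
      "\<And>g z. g \<in> carrier G \<Longrightarrow> z \<in> M \<Longrightarrow> commutator G g z \<in> N"
    by (rule p_group_normal_extension[OF p fin ord]) blast
  have "T \<subseteq> M"
    using M(1,2) max[of M] by (auto simp: \<N>_def)
  then show ?thesis
    using that[of N] N M(3) by (auto simp: \<N>_def)
qed

section \<open>The product of a class with its inverse class\<close>

text \<open>
  The product \<open>(g a g\<inverse>) (h a\<inverse> h\<inverse>)\<close> is the conjugate by \<open>h\<close> of \<open>[h\<inverse> g, a]\<close>.
\<close>
lemma (in group) conj_class_mult_inv_eq_Union:
  assumes a: "a \<in> carrier G"
  shows "conj_class G a <#> conj_class G (inv a) =
    \<Union> (conj_class G ` (\<lambda>x. commutator G x a) ` carrier G)" (is "?S = ?U")
proof
  have prod: "(g \<otimes> a \<otimes> inv g) \<otimes> (h \<otimes> inv a \<otimes> inv h) = h \<otimes> commutator G (inv h \<otimes> g) a \<otimes> inv h"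
    if "g \<in> carrier G" "h \<in> carrier G" for g h
  proof -
    have cancel: "u \<otimes> (inv u \<otimes> v) = v" if "u \<in> carrier G" "v \<in> carrier G" for u v
      using that by (simp add: m_assoc[symmetric])
    show ?thesis
      using that a by (simp add: commutator_def m_assoc inv_mult_group cancel)
  qed
  show "?S \<subseteq> ?U"
  proof
    fix s assume "s \<in> ?S"
    then obtain g h where gh: "g \<in> carrier G" "h \<in> carrier G"
        "s = (g \<otimes> a \<otimes> inv g) \<otimes> (h \<otimes> inv a \<otimes> inv h)"
      by (auto simp: set_mult_def conj_class_def)
    then have "s \<in> conj_class G (commutator G (inv h \<otimes> g) a)"
      using prod unfolding conj_class_def by blast
    moreover have "inv h \<otimes> g \<in> carrier G"
      using gh by simp
    ultimately show "s \<in> ?U"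
      by (intro UnionI[of "conj_class G (commutator G (inv h \<otimes> g) a)"] imageI)
  qed
  show "?U \<subseteq> ?S"
  proof (intro Union_least, elim imageE, simp)
    fix x assume x: "x \<in> carrier G"
    have "x \<otimes> a \<otimes> inv x \<in> conj_class G a" "inv a \<in> conj_class G (inv a)"
      using x a conj_class_self by (auto simp: conj_class_def)
    then have "commutator G x a \<in> ?S"
      unfolding commutator_def set_mult_def by blast
    then show "conj_class G (commutator G x a) \<subseteq> ?S"
      using a by (intro conj_class_least conj_class_mult_invariant) auto
  qed
qed

lemma (in group) eta_conj_class_mult_inv:
  assumes "a \<in> carrier G"
  shows "eta G (conj_class G a <#> conj_class G (inv a)) =
    card (conj_class G ` (\<lambda>x. commutator G x a) ` carrier G)"
  using assms by (intro eta_eqI conj_class_mult_inv_eq_Union) (auto simp: conj_classes_def)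

lemma (in group) card_commutators:
  assumes "a \<in> carrier G"
  shows "card ((\<lambda>x. commutator G x a) ` carrier G) = card (conj_class G a)"
proof -
  have "(\<lambda>x. commutator G x a) ` carrier G = (\<lambda>b. b \<otimes> inv a) ` conj_class G a"
    by (auto simp: conj_class_def commutator_def image_iff)
  moreover have "inj_on (\<lambda>b. b \<otimes> inv a) (conj_class G a)"
    using assms by (auto simp: inj_on_def conj_class_def)
  ultimately show ?thesis
    by (simp add: card_image)
qed

section \<open>Counting the classes of commutators\<close>

text \<open>
  The induction step. \<open>K'\<close> is the kernel of the homomorphism \<open>x \<mapsto> [x, a] N\<close> on \<open>K\<close>, where \<open>N\<close>
  is a normal subgroup modulo which all \<open>[x, a]\<close> are central, but not all trivial. A class of
  \<open>G\<close> containing some \<open>[x, a]\<close> determines the value of this homomorphism at \<open>x\<close>, so the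
  \<open>p\<^sup>j - 1\<close> nontrivial values come from as many classes that contain no \<open>[x, a]\<close> with \<open>x \<in> K'\<close>.
\<close>
lemma (in group) classes_outside_kernel:
  assumes p: "Factorial_Ring.prime (p :: nat)" and fin: "finite (carrier G)"
    and ord: "order G = p ^ n" and K: "subgroup K G" and a: "a \<in> carrier G"
    and x0: "x0 \<in> K" "commutator G x0 a \<noteq> \<one>"
  obtains K' j where "subgroup K' G" "K' \<subseteq> K" "j > 0" "card K = p ^ j * card K'"
    "{x \<in> K. commutator G x a = \<one>} \<subseteq> K'"
    "card (conj_class G ` (\<lambda>x. commutator G x a) ` K') + (p ^ j - 1)
      \<le> card (conj_class G ` (\<lambda>x. commutator G x a) ` K)"
proof -
  let ?c = "\<lambda>x. commutator G x a"
  have KG: "x \<in> carrier G" if "x \<in> K" for x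
    using that K subgroup.subset by blast
  obtain N where N: "N \<lhd> G" "\<not> ?c ` K \<subseteq> N"
      and central: "\<And>g x. g \<in> carrier G \<Longrightarrow> x \<in> K \<Longrightarrow> commutator G g (?c x) \<in> N"
  proof (rule p_group_separating_normal[OF p fin ord, of "?c ` K"])
    show "?c ` K \<subseteq> carrier G" using KG a by auto
    show "\<not> ?c ` K \<subseteq> {\<one>}" using x0 by auto
  qed blast
  interpret N: normal N G by (rule N(1))
  define Q where "Q = G Mod N"
  define \<pi> where "\<pi> = (\<lambda>x. N #> x)"
  interpret \<pi>: group_hom G Q \<pi>
    unfolding Q_def \<pi>_def by (rule N.quotient_group_hom)
  have ker: "\<pi> x = \<one>\<^bsub>Q\<^esub> \<longleftrightarrow> x \<in> N" if "x \<in> carrier G" for x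
    using N.coset_eq_one_iff[OF that] by (simp add: Q_def \<pi>_def)
  have comm: "\<pi> g \<otimes>\<^bsub>Q\<^esub> \<pi> (?c x) = \<pi> (?c x) \<otimes>\<^bsub>Q\<^esub> \<pi> g" if "g \<in> carrier G" "x \<in> K" for g x
    using central[OF that] that KG a ker[of "commutator G g (?c x)"]
      \<pi>.hom_commutator_eq_one_iff[of g "?c x"] by simp
  have conj_const: "\<pi> (g \<otimes> ?c x \<otimes> inv g) = \<pi> (?c x)" if "g \<in> carrier G" "x \<in> K" for g x
    using that KG a comm[OF that] \<pi>.H.conj_fixed_iff_commute[of "\<pi> g" "\<pi> (?c x)"] by simp
  have hom: "group_hom (G\<lparr>carrier := K\<rparr>) Q (\<lambda>x. \<pi> (?c x))"
  proof (intro group_hom.intro group_hom_axioms.intro subgroup_imp_group[OF K]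
      \<pi>.H.group_axioms homI)
    show "\<pi> (?c x) \<in> carrier Q" if "x \<in> carrier (G\<lparr>carrier := K\<rparr>)" for x
      using that KG a by (intro \<pi>.hom_closed) simp
    show "\<pi> (?c (x \<otimes>\<^bsub>G\<lparr>carrier := K\<rparr>\<^esub> y)) = \<pi> (?c x) \<otimes>\<^bsub>Q\<^esub> \<pi> (?c y)"
      if "x \<in> carrier (G\<lparr>carrier := K\<rparr>)" "y \<in> carrier (G\<lparr>carrier := K\<rparr>)" for x y
    proof -
      have xy: "x \<in> K" "y \<in> K" using that by auto
      have "\<pi> (?c (x \<otimes> y)) = \<pi> (x \<otimes> ?c y \<otimes> inv x) \<otimes>\<^bsub>Q\<^esub> \<pi> (?c x)"
        using xy KG a by (simp add: commutator_mult)
      also have "\<dots> = \<pi> (?c y) \<otimes>\<^bsub>Q\<^esub> \<pi> (?c x)"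
        using xy KG conj_const by (simp only:)
      also have "\<dots> = \<pi> (?c x) \<otimes>\<^bsub>Q\<^esub> \<pi> (?c y)"
        using xy KG a by (intro comm) simp_all
      finally show ?thesis by simp
    qed
  qed
  interpret \<phi>: group_hom "G\<lparr>carrier := K\<rparr>" "Q" "\<lambda>x. \<pi> (?c x)"
    by (rule hom)
  define K' where "K' = {x \<in> K. ?c x \<in> N}"
  define I where "I = (\<lambda>x. \<pi> (?c x)) ` K"
  have K'_kernel: "K' = kernel (G\<lparr>carrier := K\<rparr>) Q (\<lambda>x. \<pi> (?c x))"
    using ker KG a by (simp add: K'_def kernel_def cong: conj_cong)
  have cards: "card I * card K' = card K"
    using \<phi>.card_image_mult_card_kernel by (simp add: I_def K'_kernel order_def)
  have sub': "subgroup K' G"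
    using \<phi>.subgroup_kernel incl_subgroup[OF K] by (simp add: K'_kernel)
  have "card K dvd p ^ n"
    using lagrange[OF K] ord by (metis dvd_triv_right)
  then have "card I dvd p ^ n"
    using cards by (metis dvd_trans dvd_triv_left)
  then obtain j where j: "card I = p ^ j"
    using p divides_primepow_nat by blast
  have one_I: "\<one>\<^bsub>Q\<^esub> \<in> I"
    using \<phi>.hom_one subgroup.one_closed[OF K] unfolding I_def by force
  have finK: "finite K" using fin K subgroup.subset finite_subset by blast
  obtain x1 where x1: "x1 \<in> K" "?c x1 \<notin> N" using N(2) by blast
  then have "{\<one>\<^bsub>Q\<^esub>, \<pi> (?c x1)} \<subseteq> I" "\<one>\<^bsub>Q\<^esub> \<noteq> \<pi> (?c x1)"
    using one_I ker[of "?c x1"] KG a by (simp_all add: I_def)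
  then have "card I \<ge> 2"
    using card_mono[of I "{\<one>\<^bsub>Q\<^esub>, \<pi> (?c x1)}"] finK by (simp add: I_def)
  then have "j > 0" using j by (cases j) auto
  let ?A = "conj_class G ` ?c ` K" and ?B = "conj_class G ` ?c ` K'"
  \<comment> \<open>The projection is constant on each class in \<open>?A\<close>; \<open>f\<close> reads off its value.\<close>
  define f where "f C = the_elem (\<pi> ` C)" for C
  have f: "f (conj_class G (?c x)) = \<pi> (?c x)" if "x \<in> K" for x
  proof -
    have "\<pi> ` conj_class G (?c x) = {\<pi> (?c x)}"
      using that conj_const one_closed by (auto simp: conj_class_def image_iff)
    then show ?thesis by (simp add: f_def)
  qed
  have fB: "f C = \<one>\<^bsub>Q\<^esub>" if C: "C \<in> ?B" for C
  proof -
    obtain x where x: "x \<in> K" "?c x \<in> N" "C = conj_class G (?c x)"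
      using C by (auto simp: K'_def)
    then show ?thesis
      using f ker[of "?c x"] KG a by simp
  qed
  have "I - {\<one>\<^bsub>Q\<^esub>} \<subseteq> f ` (?A - ?B)"
  proof
    fix y assume y: "y \<in> I - {\<one>\<^bsub>Q\<^esub>}"
    then obtain x where x: "x \<in> K" "y = \<pi> (?c x)" by (auto simp: I_def)
    then have "y = f (conj_class G (?c x))" using f by simp
    moreover from this have "conj_class G (?c x) \<notin> ?B" using fB y by blast
    ultimately show "y \<in> f ` (?A - ?B)" using x by blast
  qed
  then have "card (I - {\<one>\<^bsub>Q\<^esub>}) \<le> card (?A - ?B)"
    using finK by (meson card_image_le card_mono finite_Diff finite_imageI le_trans)
  moreover have "card (I - {\<one>\<^bsub>Q\<^esub>}) = p ^ j - 1"
    using one_I j by simp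
  moreover have "card (?A - ?B) = card ?A - card ?B" "card ?B \<le> card ?A"
    using finK by (auto simp: K'_def intro!: card_Diff_subset card_mono)
  ultimately have count: "card ?B + (p ^ j - 1) \<le> card ?A" by linarith
  show ?thesis
    by (rule that[OF sub' _ \<open>j > 0\<close> _ _ count])
      (use cards j N.one_closed in \<open>auto simp: K'_def\<close>)
qed

text \<open>Bernoulli's inequality for \<open>p = 1 + (p - 1)\<close>.\<close>
lemma power_ge_linear:
  fixes p :: nat assumes "p \<ge> 1" shows "1 + (p - 1) * j \<le> p ^ j"
proof (induction j)
  case (Suc j)
  have "1 + (p - 1) * Suc j \<le> p ^ j + (p - 1) * 1" using Suc by simp
  also have "\<dots> \<le> p ^ j + (p - 1) * p ^ j"
    using assms by (intro add_mono mult_le_mono) auto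
  also have "\<dots> = p ^ Suc j"
    using assms by (cases p) auto
  finally show ?case .
qed simp

text \<open>
  The bound behind the theorem. It is stated for all subgroups \<open>K\<close> so that the induction can pass
  to the kernel \<open>K'\<close>, while classes are always taken in \<open>G\<close>. The hypothesis on \<open>m\<close> is an
  inequality, so that the hypothesis for \<open>K'\<close> follows by cancelling \<open>p\<^sup>j\<close>.
\<close>
theorem (in group) card_commutator_classes_ge:
  assumes p: "Factorial_Ring.prime (p :: nat)" and fin: "finite (carrier G)"
    and ord: "order G = p ^ n" and a: "a \<in> carrier G"
    and K: "subgroup K G"
    and m: "p ^ m * card {x \<in> K. commutator G x a = \<one>} \<le> card K"
  shows "1 + (p - 1) * m \<le> card (conj_class G ` (\<lambda>x. commutator G x a) ` K)"
  using K m
proof (induction "card K" arbitrary: K m rule: less_induct)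
  case less
  let ?A = "\<lambda>K. conj_class G ` (\<lambda>x. commutator G x a) ` K"
  have p1: "p > 1" using p prime_gt_1_nat by blast
  have finS: "finite H" if "subgroup H G" for H
    using that fin subgroup.subset finite_subset by blast
  have ne: "1 \<le> card (?A H)" if "subgroup H G" for H
    using finS[OF that] subgroup.one_closed[OF that] by (auto simp: Suc_le_eq card_gt_0_iff)
  show ?case
  proof (cases "\<exists>x \<in> K. commutator G x a \<noteq> \<one>")
    case False
    then have "{x \<in> K. commutator G x a = \<one>} = K" by blast
    moreover have "card K > 0"
      using finS less.prems(1) subgroup.one_closed by (fastforce simp: card_gt_0_iff)
    ultimately have "p ^ m \<le> 1" using less.prems(2) by simp
    then have "m = 0" using p1 by (cases m) (auto simp: le_Suc_eq)
    then show ?thesis using ne[OF less.prems(1)] by simp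
  next
    case True
    then obtain x where x: "x \<in> K" "commutator G x a \<noteq> \<one>" by blast
    obtain K' j where K': "subgroup K' G" "K' \<subseteq> K" "j > 0" "card K = p ^ j * card K'"
        "{x \<in> K. commutator G x a = \<one>} \<subseteq> K'"
        "card (?A K') + (p ^ j - 1) \<le> card (?A K)"
      by (rule classes_outside_kernel[OF p fin ord less.prems(1) a x]) blast
    have pj: "1 + (p - 1) * j \<le> p ^ j"
      using p1 power_ge_linear by simp
    show ?thesis
    proof (cases "m \<le> j")
      \<comment> \<open>Here one class from \<open>K'\<close> and the \<open>p\<^sup>j - 1\<close> classes outside it are already enough.\<close>
      case True
      have "1 + (p - 1) * m \<le> 1 + (p - 1) * j" using True by simp
      also have "\<dots> \<le> 1 + (p ^ j - 1)" using pj by simp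
      also have "\<dots> \<le> card (?A K)" using K'(6) ne[OF K'(1)] by linarith
      finally show ?thesis .
    next
      case False
      then obtain i where i: "m = j + i" by (metis le_Suc_ex nat_le_linear)
      have "{x \<in> K. commutator G x a = \<one>} = {x \<in> K'. commutator G x a = \<one>}"
        using K'(2,5) by blast
      then have "p ^ j * (p ^ i * card {x \<in> K'. commutator G x a = \<one>}) \<le> p ^ j * card K'"
        using less.prems(2) K'(4) i by (simp add: power_add mult.assoc)
      then have "p ^ i * card {x \<in> K'. commutator G x a = \<one>} \<le> card K'"
        using p1 by simp
      moreover have "card K' < card K"
      proof -
        have "card K' > 0"
          using finS K'(1) subgroup.one_closed by (fastforce simp: card_gt_0_iff)
        moreover have "p ^ j > 1" using p1 K'(3) by (simp only: one_less_power)
        ultimately show ?thesis using K'(4) by simp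
      qed
      ultimately have "1 + (p - 1) * i \<le> card (?A K')"
        using less.hyps K'(1) by blast
      then have "1 + (p - 1) * i + (p - 1) * j \<le> card (?A K)"
        using K'(6) pj by linarith
      then show ?thesis
        using i by (simp add: algebra_simps)
    qed
  qed
qed

theorem theoremC:
  fixes G :: "('a, 'b) monoid_scheme" and p n :: nat and a :: 'a
  assumes "Factorial_Ring.prime p"
    and "group G"
    and "finite (carrier G)"
    and "order G = p ^ n"
    and "a \<in> carrier G"
  shows "(card (conj_class G a) = 1 \<and>
            eta G (conj_class G a <#>\<^bsub>G\<^esub> conj_class G (inv\<^bsub>G\<^esub> a)) = 1) \<or>
         (card (conj_class G a) = p \<and>
            eta G (conj_class G a <#>\<^bsub>G\<^esub> conj_class G (inv\<^bsub>G\<^esub> a)) = p) \<or>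
         (card (conj_class G a) \<ge> p ^ 2 \<and>
            eta G (conj_class G a <#>\<^bsub>G\<^esub> conj_class G (inv\<^bsub>G\<^esub> a)) \<ge> 2 * p - 1)"
proof -
  interpret group G by (rule assms(2))
  let ?\<eta> = "eta G (conj_class G a <#>\<^bsub>G\<^esub> conj_class G (inv\<^bsub>G\<^esub> a))"
  have p1: "p > 1" using assms(1) prime_gt_1_nat by blast
  have stab: "card (conj_class G a) * card {x \<in> carrier G. commutator G x a = \<one>\<^bsub>G\<^esub>} = p ^ n"
    using conj_class_card[OF assms(5)] assms(4) by simp
  then obtain m where m: "card (conj_class G a) = p ^ m"
    using assms(1) divides_primepow_nat by (metis dvd_triv_left)
  have lower: "1 + (p - 1) * m \<le> ?\<eta>"
    unfolding eta_conj_class_mult_inv[OF assms(5)]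
    using assms stab m by (intro card_commutator_classes_ge subgroup_self) (auto simp: order_def)
  have "?\<eta> \<le> p ^ m"
    unfolding eta_conj_class_mult_inv[OF assms(5)] m[symmetric] card_commutators[OF assms(5), symmetric]
    using assms(3) by (intro card_image_le) auto
  consider "m = 0" | "m = 1" | "m \<ge> 2" by linarith
  then show ?thesis
  proof cases
    case 1
    then show ?thesis using lower \<open>?\<eta> \<le> p ^ m\<close> m by simp
  next
    case 2
    then show ?thesis using lower \<open>?\<eta> \<le> p ^ m\<close> m p1 by simp
  next
    case 3
    then have "p ^ 2 \<le> p ^ m" using p1 by (intro power_increasing) auto
    moreover have "2 * p - 1 = 1 + (p - 1) * 2"
      using p1 by simp
    moreover have "(p - 1) * 2 \<le> (p - 1) * m"
      using 3 by (rule mult_le_mono2)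
    ultimately show ?thesis using lower m by linarith
  qed
qed

end
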